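(* Let $G$ be a regular, countable, locally $k_{\omega}$ paratopological group. Then $G$ is a discrete topological group or $G$ contains a closed copy of $S_{\omega}$.
   Context: All spaces are $T_0$ (so a regular space is Hausdorff). A paratopological group is a group $G$ with a topology such that the product map $G\times G\to G$ is jointly continuous; it is a topological group if moreover inversion is continuous. A $k_\omega$-space is a quotient image of a topological sum of countably many compact spaces. A space is locally $k_\omega$ if each of its points has a neighborhood which (as a subspace) is a $k_\omega$-space. $S_\omega$ is the space obtained from a topological sum of countably infinitely many (nontrivial) convergent sequences, each taken with its limit point, by identifying all the limit points. A closed copy of $S_\omega$ in $G$ is a closed subspace of $G$ homeomorphic to $S_\omega$. *)

theory Defs
  imports "HOL-Analysis.Analysis" "HOL-Algebra.Group"
begin

locale paratopological_group = group G
  for G :: "('a, 'm) monoid_scheme" (structure) and T :: "'a topology" +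
  assumes topspace_eq_carrier: "topspace T = carrier G"
    and continuous_mult: "continuous_map (prod_topology T T) T (\<lambda>(x, y). x \<otimes> y)"

locale topological_group = paratopological_group +
  assumes continuous_inv: "continuous_map T T (\<lambda>x. inv x)"

text \<open>
  All spaces are \<open>T\<^sub>0\<close>, including the compact summands. A definition cannot quantify
  over types, so the type \<open>'b\<close> of the points of the summands is a parameter; a theorem
  that assumes \<open>k_omega_space TYPE('b) X\<close> for a free type variable \<open>'b\<close> covers summands
  of every type. The index set \<open>I\<close> ranges over all subsets of \<^typ>\<open>nat\<close>, that is,
  over all countable index sets up to bijection.
\<close>

definition k_omega_space :: "'b itself \<Rightarrow> 'a topology \<Rightarrow> bool" where
  "k_omega_space (_ :: 'b itself) X \<longleftrightarrow>
     t0_space X \<and>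
     (\<exists>(I :: nat set) (K :: nat \<Rightarrow> 'b topology) q.
        (\<forall>i\<in>I. compact_space (K i) \<and> t0_space (K i)) \<and>
        quotient_map (sum_topology K I) X q)"

text \<open>Neighborhoods need not be open.\<close>

definition locally_k_omega_space :: "'b itself \<Rightarrow> 'a topology \<Rightarrow> bool" where
  "locally_k_omega_space (ty :: 'b itself) X \<longleftrightarrow>
     (\<forall>x\<in>topspace X. \<exists>U N. openin X U \<and> x \<in> U \<and> U \<subseteq> N \<and> N \<subseteq> topspace X \<and>
        k_omega_space ty (subtopology X N))"

definition quotient_topology :: "'a topology \<Rightarrow> ('a \<Rightarrow> 'b) \<Rightarrow> 'b topology" where
  "quotient_topology X q =
     topology (\<lambda>U. U \<subseteq> q ` topspace X \<and> openin X {x \<in> topspace X. q x \<in> U})"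

lemma openin_quotient_topology:
  "openin (quotient_topology X q) U \<longleftrightarrow>
     U \<subseteq> q ` topspace X \<and> openin X {x \<in> topspace X. q x \<in> U}"
proof -
  have 1: "{x \<in> topspace X. q x \<in> S \<inter> V} =
      {x \<in> topspace X. q x \<in> S} \<inter> {x \<in> topspace X. q x \<in> V}" for S V
    by auto
  have 2: "{x \<in> topspace X. q x \<in> \<Union>\<K>} = (\<Union>S\<in>\<K>. {x \<in> topspace X. q x \<in> S})" for \<K>
    by auto
  have "istopology (\<lambda>U. U \<subseteq> q ` topspace X \<and> openin X {x \<in> topspace X. q x \<in> U})"
    unfolding istopology_def 1 2 by blast
  then show ?thesis
    by (simp add: quotient_topology_def topology_inverse')
qed

lemma topspace_quotient_topology: "topspace (quotient_topology X q) = q ` topspace X"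
proof -
  have "{x \<in> topspace X. q x \<in> q ` topspace X} = topspace X" by auto
  then have "openin (quotient_topology X q) (q ` topspace X)"
    by (simp add: openin_quotient_topology)
  then show ?thesis
    by (metis openin_quotient_topology openin_subset openin_topspace subset_antisym)
qed

lemma quotient_map_quotient_topology: "quotient_map X (quotient_topology X q) q"
  by (auto simp: quotient_map_def topspace_quotient_topology openin_quotient_topology)

text \<open>The nontrivial convergent sequence \<open>1, 1/2, 1/3, \<dots>\<close> together with its limit \<open>0\<close>.\<close>

definition convergent_sequence :: "real topology" where
  "convergent_sequence = top_of_set (insert 0 (range (\<lambda>n::nat. 1 / real (Suc n))))"

text \<open>The limit points \<open>(n, 0)\<close> of the countably many copies are all sent to \<open>(0, 0)\<close>;
  no other points are identified.\<close>

definition S_omega :: "(nat \<times> real) topology" where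
  "S_omega = quotient_topology (sum_topology (\<lambda>_. convergent_sequence) UNIV)
     (\<lambda>(n, x). if x = 0 then (0, 0) else (n, x))"

definition contains_closed_copy :: "'a topology \<Rightarrow> 'b topology \<Rightarrow> bool" where
  "contains_closed_copy X S \<longleftrightarrow>
     (\<exists>C. closedin X C \<and> subtopology X C homeomorphic_space S)"

end

theory Submission
  imports Defs
begin

text \<open>
  If the unit is not isolated, every compact set \<open>D\<close> containing it misses some sequence that
  converges to it. A \<open>k\<^sub>\<omega>\<close> neighborhood \<open>N\<close> of the unit carries the topology determined
  by an increasing sequence of compact sets \<open>C\<^sub>n\<close>. Choose recursively sequences \<open>S\<^sub>n\<close>
  converging to the unit and disjoint from \<open>C\<^sub>n\<close> and from all earlier \<open>S\<^sub>m\<close>. Each \<open>C\<^sub>m\<close> meets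
  only finitely many of them, so their union with the unit is a closed copy of \<open>S\<^sub>\<omega>\<close> in \<open>N\<close>;
  by regularity the sequences can be kept in a closed set inside \<open>N\<close>, which makes the copy
  closed in the group.
\<close>

section \<open>Convergent sequences as sets of points\<close>

text \<open>Recording the set of terms without an enumeration turns disjointness and passage to
  subsequences into plain set operations.\<close>

definition converging_set :: "'a topology \<Rightarrow> 'a set \<Rightarrow> 'a \<Rightarrow> bool" where
  "converging_set X S a \<longleftrightarrow> infinite S \<and> S \<subseteq> topspace X - {a} \<and> a \<in> topspace X \<and>
     (\<forall>U. openin X U \<and> a \<in> U \<longrightarrow> finite (S - U))"

lemma converging_set_subset:
  assumes "converging_set X S a" "S' \<subseteq> S" "infinite S'"
  shows "converging_set X S' a"
proof -
  have "finite (S' - U)" if "openin X U" "a \<in> U" for U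
  proof (rule finite_subset)
    show "S' - U \<subseteq> S - U" using assms(2) by auto
    show "finite (S - U)" using assms(1) that by (simp add: converging_set_def)
  qed
  then show ?thesis
    using assms by (auto simp: converging_set_def)
qed

lemma converging_set_Int_open:
  assumes S: "converging_set X S a" and V: "openin X V" "a \<in> V"
  shows "converging_set X (S \<inter> V) a"
proof -
  have "finite (S - V)" "infinite S"
    using assms unfolding converging_set_def by auto
  moreover have "S = (S - V) \<union> (S \<inter> V)" by auto
  ultimately have "infinite (S \<inter> V)" by (metis finite_UnI)
  then show ?thesis using converging_set_subset[OF S] by simp
qed

lemma compactin_insert_converging_set:
  assumes S: "converging_set X S a" and B: "B \<subseteq> S"
  shows "compactin X (insert a B)"
  unfolding compactin_def
proof (intro conjI allI impI)
  show "insert a B \<subseteq> topspace X"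
    using assms unfolding converging_set_def by auto
next
  fix \<U> assume \<U>: "(\<forall>U\<in>\<U>. openin X U) \<and> insert a B \<subseteq> \<Union>\<U>"
  then obtain U where U: "U \<in> \<U>" "a \<in> U" by auto
  then have fin: "finite (B - U)"
    using assms \<U> unfolding converging_set_def by (meson Diff_mono finite_subset order_refl)
  have "\<forall>b\<in>B. \<exists>W\<in>\<U>. b \<in> W" using \<U> by auto
  then obtain W where W: "\<And>b. b \<in> B \<Longrightarrow> W b \<in> \<U> \<and> b \<in> W b" by metis
  show "\<exists>\<F>. finite \<F> \<and> \<F> \<subseteq> \<U> \<and> insert a B \<subseteq> \<Union>\<F>"
    using fin U W by (intro exI[of _ "insert U (W ` (B - U))"]) auto
qed

text \<open>A finite range would be closed, and its complement a neighborhood of \<open>a\<close>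
  that no term enters; hence infinitely many values occur.\<close>

lemma converging_set_range:
  assumes "Hausdorff_space X" and lim: "limitin X s a sequentially"
    and s: "\<And>n::nat. s n \<in> topspace X - {a}"
  shows "converging_set X (range s) a"
proof -
  have a: "a \<in> topspace X" using lim by (simp add: limitin_def)
  have fin: "finite (range s - U)" if U: "openin X U" "a \<in> U" for U
  proof -
    obtain N where N: "\<And>n. N \<le> n \<Longrightarrow> s n \<in> U"
      using lim U unfolding limitin_sequentially by blast
    have "range s - U \<subseteq> s ` {..<N}"
      using N by (force simp: not_le[symmetric])
    then show ?thesis by (rule finite_subset) simp
  qed
  have "infinite (range s)"
  proof
    assume "finite (range s)"
    then have "compactin X (range s)"
      using s by (auto intro!: finite_imp_compactin)
    then have "closedin X (range s)"
      using assms(1) compactin_imp_closedin by blast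
    then have "openin X (topspace X - range s)" by blast
    moreover have "a \<in> topspace X - range s" using a s by auto
    ultimately show False
      using lim unfolding limitin_sequentially by blast
  qed
  then show ?thesis
    using a s fin unfolding converging_set_def by auto
qed

section \<open>Countable compact spaces\<close>

text \<open>By compactness, closed neighborhoods of \<open>a\<close> that miss the other points of \<open>C\<close> one at a time
  have finite intersections forming a countable base at \<open>a\<close> in \<open>C\<close>.\<close>

lemma sequence_in_countable_compactin:
  assumes H: "Hausdorff_space X" and C: "compactin X C" "countable C" "a \<in> C"
    and I: "a \<in> X closure_of I" "I \<subseteq> C"
  obtains x where "\<And>n::nat. x n \<in> I" "limitin X x a sequentially"
proof -
  have sub: "C \<subseteq> topspace X" using C compactin_subset_topspace by blast
  have "\<exists>U V. openin X U \<and> openin X V \<and> a \<in> U \<and> (c \<noteq> a \<longrightarrow> c \<in> V) \<and> disjnt U V" if "c \<in> C" for c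
  proof (cases "c = a")
    case True
    then show ?thesis using C sub by (intro exI[of _ "topspace X"] exI[of _ "{}"]) auto
  next
    case False
    then show ?thesis using H C sub that unfolding Hausdorff_space_def by (metis subsetD)
  qed
  then obtain U V where UV: "\<And>c. c \<in> C \<Longrightarrow> openin X (U c) \<and> openin X (V c) \<and> a \<in> U c \<and>
      (c \<noteq> a \<longrightarrow> c \<in> V c) \<and> disjnt (U c) (V c)"
    by metis
  define c where "c = from_nat_into C"
  have c: "range c = C" using C by (metis c_def empty_iff range_from_nat_into)
  define W where "W n = (\<Inter>i\<le>n. U (c i))" for n :: nat
  have "openin X (W n)" "a \<in> W n" for n
    using UV c unfolding W_def by (auto intro!: openin_INT2)
  then have "\<exists>x. x \<in> I \<inter> W n" for n
    using I by (metis IntI in_closure_of)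
  then obtain x where x: "\<And>n. x n \<in> I \<inter> W n" by metis
  have "limitin X x a sequentially"
    unfolding limitin_sequentially
  proof (intro conjI allI impI)
    show "a \<in> topspace X" using sub C by blast
  next
    fix O' assume O: "openin X O' \<and> a \<in> O'"
    \<comment> \<open>\<open>O'\<close> covers \<open>a\<close>, and \<open>V c\<close> covers any
      other \<open>c\<close>. A finite subcover uses finitely many \<open>V (c j)\<close>; once
      \<open>n\<close> reaches their indices, \<open>x n\<close> lies in every
      \<open>U (c j)\<close>, hence in none of these sets and so in \<open>O'\<close>.\<close>
    have sC: "C \<subseteq> \<Union>(insert O' (V ` C))" using UV O by auto
    have "\<exists>\<F>. finite \<F> \<and> \<F> \<subseteq> insert O' (V ` C) \<and> C \<subseteq> \<Union>\<F>"
    proof -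
      have "\<forall>A \<in> insert O' (V ` C). openin X A" using O UV by auto
      with sC show ?thesis using C(1) unfolding compactin_def by blast
    qed
    then obtain \<F> where F: "finite \<F>" "\<F> \<subseteq> insert O' (V ` C)" "C \<subseteq> \<Union>\<F>" by blast
    then have "finite (\<F> - {O'})" "\<F> - {O'} \<subseteq> V ` range c" using c by auto
    then obtain J where J: "finite J" "\<F> - {O'} = V ` c ` J"
      by (metis (no_types, lifting) finite_subset_image image_comp)
    then obtain N where N: "\<And>j. j \<in> J \<Longrightarrow> j \<le> N"
      using J(1) by (meson finite_nat_set_iff_bounded_le)
    show "\<exists>N. \<forall>n\<ge>N. x n \<in> O'"
    proof (intro exI allI impI)
      fix n assume n: "N \<le> n"
      have "x n \<notin> V (c j)" if "j \<in> J" for j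
      proof -
        have "j \<le> n" using N n that by fastforce
        then have "x n \<in> U (c j)" using x[of n] unfolding W_def by auto
        moreover have "c j \<in> C" using c by auto
        ultimately show ?thesis using UV unfolding disjnt_iff by blast
      qed
      then have no: "x n \<notin> A" if "A \<in> \<F> - {O'}" for A
        using that J(2) by auto
      have "x n \<in> C" using x I by auto
      then obtain A where "A \<in> \<F>" "x n \<in> A" using F(3) by auto
      then show "x n \<in> O'" using no[of A] by auto
    qed
  qed
  moreover have "x n \<in> I" for n using x by blast
  ultimately show thesis by (rule that[rotated])
qed

text \<open>Baire category: a nonempty open set without isolated points would be a countable union
  of closed singletons with empty interior.\<close>

lemma isolated_points_dense:
  assumes "compact_space X" "Hausdorff_space X" "countable (topspace X)"
  shows "X closure_of {x \<in> topspace X. openin X {x}} = topspace X"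
proof -
  have dense: "\<exists>y. y \<in> {x \<in> topspace X. openin X {x}} \<and> y \<in> W" if W: "openin X W" "x \<in> W" for x W
  proof (rule ccontr)
    assume "\<not> ?thesis"
    then have no: "\<And>y. y \<in> W \<Longrightarrow> \<not> openin X {y}"
      using W openin_subset by blast
    have WX: "W \<subseteq> topspace X" using W openin_subset by blast
    have "X interior_of \<Union>((\<lambda>y. {y}) ` W) = {}"
    proof (rule Baire_category_alt)
      show "completely_metrizable_space X \<or> locally_compact_space X \<and> regular_space X"
        using assms by (simp add: compact_imp_locally_compact_space compact_Hausdorff_imp_regular_space)
      show "countable ((\<lambda>y. {y}) ` W)"
        using WX assms countable_subset by blast
      fix T assume "T \<in> (\<lambda>y. {y}) ` W"
      then obtain y where y: "y \<in> W" "T = {y}" by auto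
      have "X interior_of {y} \<noteq> {y}"
        using no y by (metis openin_interior_of)
      then have "X interior_of {y} = {}"
        using interior_of_subset[of X "{y}"] by auto
      then show "closedin X T \<and> X interior_of T = {}"
        using y WX assms by (auto simp: closedin_Hausdorff_sing_eq)
    qed
    then show False using W by (simp add: interior_of_openin)
  qed
  show ?thesis
    unfolding dense_intersects_open
  proof (intro allI impI)
    fix W assume "openin X W \<and> W \<noteq> {}"
    then obtain x where "openin X W" "x \<in> W" by auto
    from dense[OF this] show "{x \<in> topspace X. openin X {x}} \<inter> W \<noteq> {}" by auto
  qed
qed

section \<open>The topology of \<open>S_omega\<close>\<close>

text \<open>Removes the metric from the sequel. Under the criterion the complement of
  \<open>V\<close> in the sequence is finite if \<open>0 \<in> V\<close>, and otherwise
  \<open>0\<close> with part of the sequence, which is compact; either way it is closed.\<close>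

lemma openin_convergent_sequence:
  "openin convergent_sequence V \<longleftrightarrow>
     V \<subseteq> insert 0 (range (\<lambda>n::nat. 1 / real (Suc n))) \<and>
     (0 \<in> V \<longrightarrow> finite {n::nat. 1 / real (Suc n) \<notin> V})"
proof -
  let ?r = "\<lambda>n::nat. 1 / real (Suc n)"
  let ?Z = "insert 0 (range ?r)"
  have inj: "inj ?r" by (auto simp: inj_on_def)
  have conv: "converging_set euclidean (range ?r) 0"
    by (rule converging_set_range) (use LIMSEQ_Suc[OF lim_1_over_n] in auto)
  have img: "?r ` {n. ?r n \<notin> V} = range ?r - V" by blast
  then have fin: "finite {n. ?r n \<notin> V} \<longleftrightarrow> finite (range ?r - V)"
    using finite_image_iff[OF inj_on_subset[OF inj subset_UNIV]] by metis
  show ?thesis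
  proof (intro iffI conjI impI)
    assume op: "openin convergent_sequence V"
    show "V \<subseteq> ?Z"
      using openin_subset[OF op] unfolding convergent_sequence_def by (simp del: of_nat_Suc)
    assume 0: "0 \<in> V"
    obtain W where W: "open W" "V = ?Z \<inter> W"
      using op unfolding convergent_sequence_def by (auto simp: openin_open)
    then have "finite (range ?r - W)"
      using conv 0 unfolding converging_set_def by auto
    moreover have "range ?r - V = range ?r - W" using W by auto
    ultimately show "finite {n. ?r n \<notin> V}" using fin by simp
  next
    assume V: "V \<subseteq> ?Z \<and> (0 \<in> V \<longrightarrow> finite {n. ?r n \<notin> V})"
    have "closed (?Z - V)"
    proof (cases "0 \<in> V")
      case True
      then have "?Z - V = range ?r - V" by auto
      then have "finite (?Z - V)" using V True fin by metis
      then show ?thesis by (rule finite_imp_closed)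
    next
      case False
      then have "?Z - V = insert 0 (range ?r - V)" by auto
      moreover have "compactin euclidean (insert 0 (range ?r - V))"
        by (rule compactin_insert_converging_set[OF conv]) auto
      ultimately show ?thesis by (simp add: compact_imp_closed)
    qed
    moreover have "V = ?Z \<inter> - (?Z - V)" using V by auto
    ultimately show "openin convergent_sequence V"
      unfolding convergent_sequence_def openin_open by blast
  qed
qed

text \<open>The last assumption makes the topology on the union as fine as convergence of all
  \<open>S n\<close> to \<open>a\<close> allows, which is the topology of the fan; for
  \<open>B\<close> the whole union it gives closedness of the copy.\<close>

lemma contains_closed_copy_S_omegaI:
  fixes S :: "nat \<Rightarrow> 'a set"
  assumes S: "\<And>n. converging_set X (S n) a" and cS: "\<And>n. countable (S n)"
    and dj: "\<And>m n. m \<noteq> n \<Longrightarrow> S m \<inter> S n = {}"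
    and closed: "\<And>B. \<lbrakk>B \<subseteq> insert a (\<Union>n. S n); a \<notin> B \<longrightarrow> (\<forall>n. finite (B \<inter> S n))\<rbrakk> \<Longrightarrow> closedin X B"
  shows "contains_closed_copy X S_omega"
proof -
  define A where "A = insert a (\<Union>n. S n)"
  have AX: "A \<subseteq> topspace X" and aS: "\<And>n. a \<notin> S n"
    using S unfolding A_def converging_set_def by auto
  let ?r = "\<lambda>n::nat. 1 / real (Suc n)"
  let ?Z = "insert 0 (range ?r)"
  let ?q = "\<lambda>(n::nat, x::real). if x = 0 then (0, 0) else (n, x)"
  have topZ: "topspace convergent_sequence = ?Z"
    unfolding convergent_sequence_def by simp
  have topS: "topspace S_omega = insert (0, 0) (UNIV \<times> range ?r)" (is "_ = ?T")
    unfolding S_omega_def topspace_quotient_topology by (force simp: topZ image_iff)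
  \<comment> \<open>Preimages under the identification are tested copy by copy. Points off the
    vertex impose no condition; at the vertex the finite exceptional sets of different copies are
    unrelated.\<close>
  have openS: "openin S_omega W \<longleftrightarrow>
      W \<subseteq> ?T \<and> ((0,0) \<in> W \<longrightarrow> (\<forall>n. finite {k. (n, ?r k) \<notin> W}))" for W
  proof -
    have "openin S_omega W \<longleftrightarrow> W \<subseteq> ?T \<and>
       (\<forall>n. openin convergent_sequence {x \<in> ?Z. ?q (n, x) \<in> W})"
      using topS
      unfolding S_omega_def openin_quotient_topology topspace_quotient_topology
        openin_sum_topology
      by (auto simp: topZ Collect_conj_eq)
    then show ?thesis
      unfolding openin_convergent_sequence by auto
  qed
  define b where "b n = from_nat_into (S n)" for n
  have b: "bij_betw (b n) UNIV (S n)" for n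
    unfolding b_def using S cS by (auto simp: converging_set_def intro: bij_betw_from_nat_into)
  have bS: "b n k \<in> S n" for n k using b by (auto simp: bij_betw_def)
  have b_eq: "b n k = b m l \<longleftrightarrow> n = m \<and> k = l" for n k m l
  proof
    assume eq: "b n k = b m l"
    then have "n = m" using bS dj by (metis IntI empty_iff)
    then show "n = m \<and> k = l" using eq b by (auto simp: bij_betw_def inj_on_def)
  qed auto
  \<comment> \<open>The index is determined when \<open>x = 1 / real (Suc k)\<close>; at other
    nonzero reals the choice is arbitrary, but those points lie outside
    \<open>topspace S_omega\<close>.\<close>
  define h where "h = (\<lambda>(n::nat, x::real). if x = 0 then a else b n (SOME k. x = ?r k))"
  have h0: "h (0, 0) = a" by (simp add: h_def)
  have hr: "h (n, ?r k) = b n k" for n k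
  proof -
    have "(SOME j. ?r k = ?r j) = k" by (rule some_equality) auto
    then show ?thesis by (simp add: h_def)
  qed
  have fin: "finite {k. b n k \<notin> U} \<longleftrightarrow> finite (S n - U)" for n U
  proof -
    have "S n - U = b n ` {k. b n k \<notin> U}"
      using b[of n] by (auto simp: bij_betw_def)
    moreover have "inj_on (b n) {k. b n k \<notin> U}"
      using b[of n] by (auto simp: bij_betw_def inj_on_def)
    ultimately show ?thesis by (simp add: finite_image_iff)
  qed
  have openA: "openin (subtopology X A) U \<longleftrightarrow> (a \<in> U \<longrightarrow> (\<forall>n. finite (S n - U)))"
    if "U \<subseteq> A" for U
  proof
    assume "openin (subtopology X A) U"
    then obtain W where W: "openin X W" "U = W \<inter> A" by (auto simp: openin_subtopology)
    show "a \<in> U \<longrightarrow> (\<forall>n. finite (S n - U))"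
    proof (intro impI allI)
      fix n assume "a \<in> U"
      then have "finite (S n - W)" using W S unfolding converging_set_def by auto
      moreover have "S n - U = S n - W" using W unfolding A_def by auto
      ultimately show "finite (S n - U)" by simp
    qed
  next
    assume U: "a \<in> U \<longrightarrow> (\<forall>n. finite (S n - U))"
    \<comment> \<open>If \<open>a\<close> is in \<open>U\<close>, the complement
      \<open>A - U\<close> omits \<open>a\<close> and meets each \<open>S n\<close> in a finite set;
      otherwise it contains \<open>a\<close>. Either way \<open>closed\<close> applies.\<close>
    have "closedin X (A - U)"
    proof (rule closed)
      show "A - U \<subseteq> insert a (\<Union>n. S n)" by (auto simp: A_def)
      have "(A - U) \<inter> S n = S n - U" for n by (auto simp: A_def)
      then show "a \<notin> A - U \<longrightarrow> (\<forall>n. finite ((A - U) \<inter> S n))"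
        using U by (auto simp: A_def)
    qed
    moreover have "U = (topspace X - (A - U)) \<inter> A" using that AX by auto
    ultimately show "openin (subtopology X A) U"
      unfolding openin_subtopology by blast
  qed
  have "homeomorphic_map S_omega (subtopology X A) h"
    unfolding homeomorphic_map_def quotient_map_def
  proof (intro conjI allI impI)
    have "range (b n) = S n" for n using b by (auto simp: bij_betw_def)
    moreover have "h ` ?T = insert a (\<Union>n. range (b n))"
    proof -
      have "h ` (UNIV \<times> range ?r) = (\<Union>n. range (\<lambda>k. h (n, ?r k)))"
        by blast
      then show ?thesis by (simp add: h0 hr del: of_nat_Suc)
    qed
    ultimately show "h ` topspace S_omega = topspace (subtopology X A)"
      using AX by (simp add: topS A_def inf.absorb2)
    show "inj_on h (topspace S_omega)"
    proof -
      have "a \<noteq> b n k" for n k using aS bS by metis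
      then show ?thesis
        unfolding topS inj_on_def by (auto simp: h0 hr b_eq simp del: of_nat_Suc)
    qed
  next
    fix U assume "U \<subseteq> topspace (subtopology X A)"
    then have U: "U \<subseteq> A" by auto
    have "{k. (n, ?r k) \<notin> {x \<in> ?T. h x \<in> U}} = {k. b n k \<notin> U}" for n
      by (auto simp: hr simp del: of_nat_Suc)
    moreover have "(0, 0) \<in> {x \<in> ?T. h x \<in> U} \<longleftrightarrow> a \<in> U"
      by (simp add: h0)
    moreover have "{x \<in> ?T. h x \<in> U} \<subseteq> ?T" by (rule Collect_subset)
    ultimately show "openin S_omega {x \<in> topspace S_omega. h x \<in> U} = openin (subtopology X A) U"
      unfolding openA[OF U] topS openS by (simp only: fin simp_thms)
  qed
  then have "subtopology X A homeomorphic_space S_omega"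
    using homeomorphic_map_imp_homeomorphic_space homeomorphic_space_sym by metis
  moreover have "closedin X A"
    by (rule closed) (auto simp: A_def)
  ultimately show ?thesis
    unfolding contains_closed_copy_def by (intro exI[of _ A] conjI)
qed

section \<open>Compact sets determining a \<open>k_omega\<close>-space\<close>

text \<open>Finite unions of the images of the summands serve as \<open>C n\<close>: closedness in a
  quotient of a sum can be tested on each summand.\<close>

lemma k_omega_space_compact_family:
  assumes H: "Hausdorff_space X" and k: "k_omega_space TYPE('b) (subtopology X N)"
    and N: "N \<subseteq> topspace X"
  obtains C :: "nat \<Rightarrow> 'a set"
  where "\<And>n. compactin X (C n)" and "\<And>n. C n \<subseteq> N"
    and "\<And>m n. m \<le> n \<Longrightarrow> C m \<subseteq> C n"
    and "\<forall>B\<subseteq>N. (\<forall>n. closedin X (B \<inter> C n)) \<longrightarrow> closedin (subtopology X N) B"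
proof -
  obtain I :: "nat set" and K :: "nat \<Rightarrow> 'b topology" and q
    where K: "\<And>i. i \<in> I \<Longrightarrow> compact_space (K i)"
      and q: "quotient_map (sum_topology K I) (subtopology X N) q"
    using k unfolding k_omega_space_def by blast
  have cont: "continuous_map (K i) X (\<lambda>x. q (i, x))" if "i \<in> I" for i
  proof -
    have "continuous_map (K i) (subtopology X N) (q \<circ> (\<lambda>x. (i, x)))"
      using continuous_map_component_injection[OF that] quotient_imp_continuous_map[OF q]
      by (rule continuous_map_compose)
    then show ?thesis by (simp add: o_def continuous_map_in_subtopology)
  qed
  define C where "C n = (\<Union>i \<in> I \<inter> {..n}. (\<lambda>x. q (i, x)) ` topspace (K i))" for n
  show thesis
  proof
    show "compactin X (C n)" for n
      unfolding C_def
    proof (rule compactin_Union)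
      fix S assume "S \<in> (\<lambda>i. (\<lambda>x. q (i, x)) ` topspace (K i)) ` (I \<inter> {..n})"
      then obtain i where i: "i \<in> I" "S = (\<lambda>x. q (i, x)) ` topspace (K i)" by auto
      then show "compactin X S"
        using image_compactin[OF _ cont[OF i(1)]] K[OF i(1)] by (simp add: compact_space_def)
    qed auto
    have "q ` topspace (sum_topology K I) \<subseteq> N"
      using quotient_imp_surjective_map[OF q] by auto
    then show "C n \<subseteq> N" for n
      unfolding C_def by (auto simp: image_subset_iff)
    show "C m \<subseteq> C n" if "m \<le> n" for m n
      using that unfolding C_def by force
    show "\<forall>B\<subseteq>N. (\<forall>n. closedin X (B \<inter> C n)) \<longrightarrow> closedin (subtopology X N) B"
    proof (intro allI impI)
      fix B assume B: "B \<subseteq> N" and cl: "\<forall>n. closedin X (B \<inter> C n)"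
      \<comment> \<open>The summand \<open>K i\<close> is mapped into \<open>C i\<close>, so it sees
        \<open>B\<close> only through \<open>B \<inter> C i\<close>.\<close>
      have "closedin (K i) {x. (i, x) \<in> {p \<in> topspace (sum_topology K I). q p \<in> B}}"
        if i: "i \<in> I" for i
      proof -
        have "closedin (K i) {x \<in> topspace (K i). q (i, x) \<in> B \<inter> C i}"
          using cont[OF i] cl[rule_format, of i] by (rule closedin_continuous_map_preimage)
        moreover have "{x \<in> topspace (K i). q (i, x) \<in> B \<inter> C i} =
            {x. (i, x) \<in> {p \<in> topspace (sum_topology K I). q p \<in> B}}"
          using i by (auto simp: C_def)
        ultimately show ?thesis by simp
      qed
      then have "closedin (sum_topology K I) {p \<in> topspace (sum_topology K I). q p \<in> B}"
        unfolding closedin_sum_topology by auto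
      moreover have "B \<subseteq> topspace (subtopology X N)" using B N by auto
      ultimately show "closedin (subtopology X N) B"
        using q unfolding quotient_map_closedin by blast
    qed
  qed
qed

section \<open>Sequences converging to the unit of the group\<close>

context paratopological_group
begin

lemma limitin_mult:
  assumes "limitin T f a F" "limitin T g b F"
  shows "limitin T (\<lambda>i. f i \<otimes> g i) (a \<otimes> b) F"
proof -
  have "limitin (prod_topology T T) (\<lambda>i. (f i, g i)) (a, b) F"
    using assms by (simp add: limitin_pairwise o_def)
  from continuous_map_limit[OF continuous_mult this] show ?thesis
    by (simp add: o_def)
qed

text \<open>Isolated points \<open>x\<^sub>k\<close> of \<open>D\<close> converge to the unit. Since \<open>x\<^sub>k \<otimes> y\<^sub>j\<close> tends to \<open>x\<^sub>k\<close> and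
  never equals it, it leaves \<open>D\<close> as \<open>j\<close> grows, while \<open>x\<^sub>k \<otimes> y\<^bsub>j(k)\<^esub>\<close> tends to the unit.\<close>

lemma sequence_avoiding_compactin:
  assumes H: "Hausdorff_space T" and count: "countable (carrier G)"
    and D: "compactin T D" "\<one> \<in> D"
    and y: "limitin T y \<one> sequentially" "\<And>n::nat. y n \<in> carrier G - {\<one>}"
  obtains s :: "nat \<Rightarrow> 'a"
  where "limitin T s \<one> sequentially" "\<And>n. s n \<in> carrier G - D"
proof -
  have DG: "D \<subseteq> carrier G"
    using D compactin_subset_topspace topspace_eq_carrier by metis
  then have cD: "countable D" using count countable_subset by metis
  define I where "I = {x \<in> D. openin (subtopology T D) {x}}"
  have tD: "topspace (subtopology T D) = D" using DG topspace_eq_carrier by auto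
  have "{x \<in> topspace (subtopology T D). openin (subtopology T D) {x}} = I"
    unfolding I_def tD by simp
  then have "subtopology T D closure_of I = D"
    using isolated_points_dense[of "subtopology T D"] D(1) H cD
    unfolding tD by (simp add: compact_space_subtopology Hausdorff_space_subtopology)
  moreover have "I \<subseteq> D" by (auto simp: I_def)
  ultimately have "\<one> \<in> T closure_of I"
    using D by (auto simp: closure_of_subtopology Int_absorb1)
  \<comment> \<open>If the unit is itself isolated in \<open>D\<close>, \<open>x\<close> may be the
    constant unit; the argument below covers this case.\<close>
  then obtain x where x: "\<And>n::nat. x n \<in> I" "limitin T x \<one> sequentially"
    using sequence_in_countable_compactin[OF H D(1) cD D(2) _ \<open>I \<subseteq> D\<close>] by blast
  have xG: "x k \<in> carrier G" for k using x DG by (auto simp: I_def)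
  have "\<exists>J. \<forall>j\<ge>J. x k \<otimes> y j \<notin> D" for k
  proof -
    \<comment> \<open>\<open>x k\<close> is isolated only relative to \<open>D\<close>, so
      \<open>W\<close> meets \<open>D\<close> in \<open>x k\<close> alone. By cancellation
      \<open>x k \<otimes> y j\<close> differs from \<open>x k\<close>, hence is outside
      \<open>D\<close> once it is in \<open>W\<close>.\<close>
    obtain W where W: "openin T W" "{x k} = W \<inter> D"
      using x(1)[of k] unfolding I_def by (auto simp: openin_subtopology)
    have "limitin T (\<lambda>j. x k \<otimes> y j) (x k) sequentially"
      using limitin_mult[of "\<lambda>_. x k" "x k" sequentially y \<one>] y(1) xG[of k] topspace_eq_carrier
      by simp
    moreover have "x k \<in> W" using W by auto
    ultimately obtain J where J: "\<And>j. j \<ge> J \<Longrightarrow> x k \<otimes> y j \<in> W"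
      using W unfolding limitin_sequentially by meson
    moreover have "x k \<otimes> y j \<noteq> x k" for j
      using xG[of k] y(2)[of j] by auto
    ultimately have "x k \<otimes> y j \<notin> D" if "j \<ge> J" for j
      using W(2) that by blast
    then show ?thesis by auto
  qed
  then obtain J where J: "\<And>k j. j \<ge> J k \<Longrightarrow> x k \<otimes> y j \<notin> D" by metis
  \<comment> \<open>\<open>j k \<ge> k\<close> keeps \<open>y (j k)\<close> convergent to the unit,
    and \<open>j k \<ge> J k\<close> keeps the product outside \<open>D\<close>.\<close>
  define j where "j k = max k (J k)" for k
  show thesis
  proof
    have "limitin T (\<lambda>k. y (j k)) \<one> sequentially"
      unfolding limitin_sequentially
    proof (intro conjI allI impI)
      show "\<one> \<in> topspace T" by (simp add: topspace_eq_carrier)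
      fix U assume "openin T U \<and> \<one> \<in> U"
      then obtain M where "\<And>n. n \<ge> M \<Longrightarrow> y n \<in> U"
        using y(1) unfolding limitin_sequentially by meson
      then show "\<exists>M. \<forall>k\<ge>M. y (j k) \<in> U"
        unfolding j_def by (intro exI[of _ M]) auto
    qed
    from limitin_mult[OF x(2) this]
    show "limitin T (\<lambda>k. x k \<otimes> y (j k)) \<one> sequentially" by simp
    show "x k \<otimes> y (j k) \<in> carrier G - D" for k
      using J[of k "j k"] xG y(2) by (auto simp: j_def)
  qed
qed

text \<open>Left translation by \<open>inv g\<close> is continuous, being the product with one
  factor fixed, and pulls \<open>{\<one>}\<close> back to \<open>{g}\<close>.\<close>

lemma discrete_if_openin_one:
  assumes "openin T {\<one>}"
  shows "T = discrete_topology (carrier G)"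
proof -
  have "openin T {g}" if g: "g \<in> carrier G" for g
  proof -
    have "continuous_map T (prod_topology T T) (\<lambda>x. (inv g, x))"
      using g by (simp add: continuous_map_pairedI topspace_eq_carrier)
    then have "continuous_map T T ((\<lambda>(x, y). x \<otimes> y) \<circ> (\<lambda>x. (inv g, x)))"
      using continuous_mult by (rule continuous_map_compose)
    then have "openin T {x \<in> topspace T. inv g \<otimes> x \<in> {\<one>}}"
      using openin_continuous_map_preimage[OF _ assms] by (simp add: o_def)
    moreover have "{x \<in> topspace T. inv g \<otimes> x \<in> {\<one>}} = {g}"
      using g topspace_eq_carrier by (auto simp: inv_solve_left')
    ultimately show ?thesis by simp
  qed
  then show ?thesis
    using discrete_topology_unique[of "carrier G" T] topspace_eq_carrier by simp
qed

text \<open>Were all \<open>C n - {\<one>}\<close> closed, \<open>N - {\<one>}\<close> would be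
  closed in \<open>N\<close>, making \<open>{\<one>}\<close> open because \<open>U\<close> is open
  inside \<open>N\<close>. So in some \<open>C n\<close> the unit is a limit of other points, and
  countability yields a sequence.\<close>

lemma nontrivial_sequence:
  assumes H: "Hausdorff_space T" and count: "countable (carrier G)"
    and N: "openin T U" "\<one> \<in> U" "U \<subseteq> N" "N \<subseteq> topspace T" and C: "\<And>n::nat. compactin T (C n)" "\<And>n. C n \<subseteq> N"
    and det: "\<forall>B\<subseteq>N. (\<forall>n. closedin T (B \<inter> C n)) \<longrightarrow> closedin (subtopology T N) B"
    and nd: "\<not> openin T {\<one>}"
  obtains y :: "nat \<Rightarrow> 'a"
  where "limitin T y \<one> sequentially" "\<And>n. y n \<in> carrier G - {\<one>}"
proof -
  have "\<not> closedin (subtopology T N) (N - {\<one>})"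
  proof
    assume "closedin (subtopology T N) (N - {\<one>})"
    then obtain F where F: "closedin T F" "N - {\<one>} = F \<inter> N"
      by (auto simp: closedin_subtopology)
    then have "openin T (U - F)" using N by (simp add: openin_diff)
    moreover have "U - F = {\<one>}" using F N by auto
    ultimately show False using nd by simp
  qed
  then obtain n where n: "\<not> closedin T ((N - {\<one>}) \<inter> C n)"
    using det by blast
  define E where "E = C n - {\<one>}"
  have nE: "\<not> closedin T E"
  proof -
    have "(N - {\<one>}) \<inter> C n = E" using C(2)[of n] by (auto simp: E_def)
    then show ?thesis using n by simp
  qed
  have clC: "closedin T (C n)" and sub: "E \<subseteq> C n" "E \<subseteq> topspace T"
    using C(1)[of n] H compactin_subset_topspace compactin_imp_closedin by (auto simp: E_def)
  \<comment> \<open>\<open>C n\<close> is closed, so the closure of \<open>E\<close> can add only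
    the unit, and it does since \<open>E\<close> is not closed.\<close>
  have "T closure_of E \<subseteq> C n"
    using clC sub by (simp add: closure_of_minimal)
  moreover have "\<not> T closure_of E \<subseteq> E"
    using nE sub closure_of_subset_eq by metis
  ultimately have one: "\<one> \<in> T closure_of E" and oneC: "\<one> \<in> C n" by (auto simp: E_def)
  have "countable (C n)"
    using compactin_subset_topspace[OF C(1)[of n]] count countable_subset topspace_eq_carrier by metis
  then obtain y where y: "\<And>k. y k \<in> E" "limitin T y \<one> sequentially"
    using sequence_in_countable_compactin[OF H C(1) _ oneC one sub(1)] by metis
  have "y k \<in> carrier G - {\<one>}" for k
    using y(1)[of k] sub topspace_eq_carrier by (auto simp: E_def)
  with y(2) show thesis by (rule that)
qed

section \<open>Recursive construction of the fan\<close>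

lemma contains_closed_copy_S_omega_if_not_openin_one:
  assumes H: "Hausdorff_space T" and reg: "regular_space T" and count: "countable (carrier G)"
    and lk: "locally_k_omega_space TYPE('b) T" and nd: "\<not> openin T {\<one>}"
  shows "contains_closed_copy T S_omega"
proof -
  obtain U N where U: "openin T U" "\<one> \<in> U" "U \<subseteq> N" and N: "N \<subseteq> topspace T"
    and k: "k_omega_space TYPE('b) (subtopology T N)"
    using lk unfolding locally_k_omega_space_def topspace_eq_carrier by (meson one_closed)
  obtain C :: "nat \<Rightarrow> 'a set" where C: "\<And>n. compactin T (C n)" "\<And>n. C n \<subseteq> N"
    and mono: "\<And>m n. m \<le> n \<Longrightarrow> C m \<subseteq> C n"
    and det: "\<forall>B\<subseteq>N. (\<forall>n. closedin T (B \<inter> C n)) \<longrightarrow> closedin (subtopology T N) B"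
    using k_omega_space_compact_family[OF H k N] by metis
  obtain y where y: "limitin T y \<one> sequentially" "\<And>n::nat. y n \<in> carrier G - {\<one>}"
    using nontrivial_sequence[OF H count U N C det nd] by metis
  obtain V F where V: "openin T V" "\<one> \<in> V" "V \<subseteq> F" and F: "closedin T F" "F \<subseteq> U"
  proof -
    have "neighbourhood_base_of (closedin T) T"
      using reg neighbourhood_base_of_closedin by blast
    then show thesis
      using that U unfolding neighbourhood_base_of by metis
  qed
  have avoid: "\<exists>S. converging_set T S \<one> \<and> S \<subseteq> V - D" if D: "compactin T D" "\<one> \<in> D" for D
  proof -
    obtain s where s: "limitin T s \<one> sequentially" "\<And>n::nat. s n \<in> carrier G - D"
      using sequence_avoiding_compactin[OF H count D y] by metis
    have "s n \<in> topspace T - {\<one>}" for n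
      using s(2)[of n] D(2) topspace_eq_carrier by auto
    with s(1) have "converging_set T (range s) \<one>"
      by (rule converging_set_range[OF H])
    then have "converging_set T (range s \<inter> V) \<one>"
      using V by (intro converging_set_Int_open)
    moreover have "range s \<inter> V \<subseteq> V - D" using s(2) by auto
    ultimately show ?thesis by (intro exI[of _ "range s \<inter> V"] conjI)
  qed
  \<comment> \<open>In a state \<open>(D, S)\<close> of the recursion \<open>D\<close> is the
    compact set to be avoided and \<open>S\<close> the sequence found off it. \<open>Q\<close>
    passes both into the next compact set, which makes the sequences pairwise disjoint.\<close>
  define P where "P n p \<longleftrightarrow> (case p of (D, S) \<Rightarrow> compactin T D \<and> \<one> \<in> D \<and> C n \<subseteq> D \<and>
      converging_set T S \<one> \<and> S \<subseteq> V - D)" for n p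
  define Q where "Q (n::nat) p p' \<longleftrightarrow> (case p of (D, S) \<Rightarrow> D \<union> S \<subseteq> fst p')"
    for n and p p' :: "'a set \<times> 'a set"
  have "\<exists>f. \<forall>n. P n (f n) \<and> Q n (f n) (f (Suc n))"
  proof (rule dependent_nat_choice)
    have D: "compactin T (insert \<one> (C 0))"
      using compactin_Un[OF _ C(1), of "{\<one>}" 0] topspace_eq_carrier by simp
    from avoid[OF D] obtain S where "converging_set T S \<one>" "S \<subseteq> V - insert \<one> (C 0)" by auto
    with D show "\<exists>p. P 0 p"
      unfolding P_def by (intro exI[of _ "(insert \<one> (C 0), S)"]) auto
  next
    fix p n assume "P n p"
    then obtain D S where p: "p = (D, S)" and DS: "compactin T D" "\<one> \<in> D" "converging_set T S \<one>"
      unfolding P_def by (cases p) auto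
    \<comment> \<open>The unit is adjoined because \<open>S\<close> becomes compact only with its
      limit.\<close>
    define D' where "D' = D \<union> insert \<one> S \<union> C (Suc n)"
    have D': "compactin T D'"
      unfolding D'_def
      by (intro compactin_Un compactin_insert_converging_set[OF DS(3) subset_refl] DS(1) C(1))
    then obtain S' where "converging_set T S' \<one>" "S' \<subseteq> V - D'"
      using avoid[of D'] by (auto simp: D'_def)
    with D' p show "\<exists>p'. P (Suc n) p' \<and> Q n p p'"
      unfolding P_def Q_def by (intro exI[of _ "(D', S')"]) (auto simp: D'_def)
  qed
  then obtain f where f: "\<And>n. P n (f n)" "\<And>n. Q n (f n) (f (Suc n))" by metis
  define D where "D n = fst (f n)" for n
  define S where "S n = snd (f n)" for n
  have S: "converging_set T (S n) \<one>" "S n \<subseteq> V - D n" and CD: "C n \<subseteq> D n" for n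
    using f(1)[of n] unfolding P_def D_def S_def by (auto simp: case_prod_beta)
  have step: "D n \<union> S n \<subseteq> D (Suc n)" for n
    using f(2)[of n] unfolding Q_def D_def S_def by (simp add: case_prod_beta)
  have D_mono: "D m \<subseteq> D n" if "m \<le> n" for m n
    by (rule lift_Suc_mono_le[of D, OF _ that]) (use step in blast)
  have S_D: "S m \<subseteq> D n" if "m < n" for m n
    using step[of m] D_mono[of "Suc m" n] that by auto
  have S_less: "S m \<inter> S n = {}" if "m < n" for m n
    using S_D[OF that] S(2)[of n] by auto
  have S_C: "S n \<inter> C m = {}" if "m \<le> n" for m n
    using CD[of n] mono[OF that] S(2)[of n] by auto
  show ?thesis
  proof (rule contains_closed_copy_S_omegaI)
    show "converging_set T (S n) \<one>" for n by (rule S(1))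
    show "countable (S n)" for n
      using S(1)[of n] count topspace_eq_carrier unfolding converging_set_def
      by (metis Diff_subset countable_subset subset_trans)
    show "S m \<inter> S n = {}" if "m \<noteq> n" for m n
      using that S_less[of m n] S_less[of n m] by (metis Int_commute linorder_neqE_nat)
  next
    fix B assume B: "B \<subseteq> insert \<one> (\<Union>n. S n)" "\<one> \<notin> B \<longrightarrow> (\<forall>n. finite (B \<inter> S n))"
    have BF: "B \<subseteq> F" using B(1) S(2) V by auto
    have FN: "F \<subseteq> N" using F U by auto
    have "closedin T (B \<inter> C m)" for m
    proof -
      \<comment> \<open>Only sequences with index below \<open>m\<close> can meet
        \<open>C m\<close>, so \<open>E\<close> holds all of \<open>B\<close> that matters there. If
        the unit is in \<open>B\<close>, \<open>E\<close> is a finite union of compact sets;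
        otherwise it is finite.\<close>
      define E where "E = (B \<inter> {\<one>}) \<union> (\<Union>n<m. B \<inter> S n)"
      have "compactin T E"
      proof (cases "\<one> \<in> B")
        case True
        have "compactin T (insert \<one> (B \<inter> S n))" for n
          by (rule compactin_insert_converging_set[OF S(1)]) auto
        \<comment> \<open>The separate \<open>{\<one>}\<close> accounts for \<open>m = 0\<close>,
          where the indexed union is empty.\<close>
        then have "compactin T ({\<one>} \<union> (\<Union>n<m. insert \<one> (B \<inter> S n)))"
          using topspace_eq_carrier by (intro compactin_Un compactin_Union) auto
        moreover have "E = {\<one>} \<union> (\<Union>n<m. insert \<one> (B \<inter> S n))"
          using True by (auto simp: E_def)
        ultimately show ?thesis by simp
      next
        case False
        then have "finite E"
          unfolding E_def using B(2) by (intro finite_UnI finite_UN_I) auto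
        moreover have "E \<subseteq> topspace T"
          using BF F(1) closedin_subset by (auto simp: E_def)
        ultimately show ?thesis by (rule finite_imp_compactin[rotated])
      qed
      then have "closedin T (E \<inter> C m)"
        using C(1) H compactin_imp_closedin by (metis closedin_Int)
      moreover have "B \<inter> C m = E \<inter> C m"
      proof
        show "B \<inter> C m \<subseteq> E \<inter> C m"
        proof
          fix x assume x: "x \<in> B \<inter> C m"
          then consider "x = \<one>" | n where "x \<in> S n" using B(1) by auto
          then show "x \<in> E \<inter> C m"
          proof cases
            case 2
            then have "n < m" using S_C[of m n] x by (metis IntD2 IntI empty_iff not_le)
            then show ?thesis using x 2 by (auto simp: E_def)
          qed (use x in \<open>auto simp: E_def\<close>)
        qed
      qed (auto simp: E_def)
      ultimately show ?thesis by simp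
    qed
    then have "closedin (subtopology T N) B"
      using det BF FN by auto
    \<comment> \<open>Since \<open>B \<subseteq> F \<subseteq> N\<close>, the set \<open>Z\<close>
      may be cut with \<open>F\<close> instead of \<open>N\<close>, and \<open>F\<close> is closed
      in the whole group.\<close>
    then obtain Z where Z: "closedin T Z" "B = Z \<inter> N" by (auto simp: closedin_subtopology)
    then have "B = Z \<inter> F" using BF FN by auto
    then show "closedin T B" using Z(1) F(1) by (simp add: closedin_Int)
  qed
qed

end

theorem theorem5p3:
  fixes G :: "('a, 'm) monoid_scheme" and T :: "'a topology"
  assumes "paratopological_group G T"
    and "t0_space T"
    and "regular_space T"
    and "countable (carrier G)"
    and "locally_k_omega_space TYPE('b) T"
  shows "(topological_group G T \<and> T = discrete_topology (carrier G)) \<or>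
    contains_closed_copy T S_omega"
proof -
  interpret paratopological_group G T by (rule assms(1))
  have H: "Hausdorff_space T"
    using assms(2,3) by (simp add: regular_t0_imp_Hausdorff_space)
  show ?thesis
  proof (cases "openin T {\<one>\<^bsub>G\<^esub>}")
    case True
    then have T: "T = discrete_topology (carrier G)" by (rule discrete_if_openin_one)
    have "continuous_map T T (\<lambda>x. inv\<^bsub>G\<^esub> x)"
      unfolding T by auto
    then have "topological_group G T"
      by unfold_locales
    with T show ?thesis by simp
  next
    case False
    then show ?thesis
      using contains_closed_copy_S_omega_if_not_openin_one[OF H assms(3-5)] by blast
  qed
qed

end
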